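(* Let $d\ge 1$, let $A\subset \mathbb{R}^d$ be a non-meager Baire set, and let $P=\{v^i\}_{i\in\mathbb{N}}$ be a bounded sequence of points in $\mathbb{R}^d$. Then the set $$\Delta_P(A)=\{t>0 : \text{there exists } z\in\mathbb{R}^d \text{ such that } tP+z\subset A\}$$ has nonempty interior in $\mathbb{R}$.
   Context: A subset of a topological space is meager (first category) if it is a countable union of nowhere dense sets, and non-meager if it is not meager. A subset $A$ of a topological space $X$ is called Baire if there exist an open set $U$ and a meager set $M$ such that $A$ equals the symmetric difference of $U$ and $M$ (i.e., $A$ has the property of Baire). Here $tP+z=\{tv^i+z : i\in\mathbb{N}\}$, and $\mathbb{R}^d$ carries its usual topology; bounded means $\sup_i|v^i|<\infty$. *)

theory Defs
  imports "HOL-Analysis.Analysis"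
begin

definition nowhere_dense :: "'a::topological_space set \<Rightarrow> bool" where
  "nowhere_dense S \<longleftrightarrow> interior (closure S) = {}"

text \<open>Finite or empty unions are covered as well, since the empty set is nowhere dense.\<close>

definition meager :: "'a::topological_space set \<Rightarrow> bool" where
  "meager S \<longleftrightarrow> (\<exists>N :: nat \<Rightarrow> 'a set. (\<forall>n. nowhere_dense (N n)) \<and> S = (\<Union>n. N n))"

definition baire_set :: "'a::topological_space set \<Rightarrow> bool" where
  "baire_set A \<longleftrightarrow> (\<exists>U M. open U \<and> meager M \<and> A = sym_diff U M)"

definition pattern_scales :: "(nat \<Rightarrow> 'a::real_vector) \<Rightarrow> 'a set \<Rightarrow> real set" where
  "pattern_scales v A = {t. t > 0 \<and> (\<exists>z. range (\<lambda>i. t *\<^sub>R v i + z) \<subseteq> A)}"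

end

theory Submission
  imports Defs
begin

text \<open>
  Write \<open>A\<close> as the symmetric difference of an open set \<open>U\<close> and a meager set \<open>M\<close>. Since
  \<open>A\<close> is not meager, \<open>U\<close> contains a ball of some radius \<open>r\<close> and centre \<open>c\<close>. If \<open>t > 0\<close> is so small
  that every \<open>t v\<^sup>i\<close> has norm less than \<open>r / 2\<close>, then for every \<open>z\<close> within \<open>r / 2\<close> of \<open>c\<close> the whole
  pattern \<open>t P + z\<close> lies in \<open>U\<close>. It avoids \<open>M\<close>, and hence lies in \<open>A\<close>, unless \<open>z\<close> is
  in one of the countably many translates \<open>M - t v\<^sup>i\<close>. The union of these translates is meager, so by the
  Baire category theorem (\<open>open_diff_meager_nonempty\<close>) it cannot cover the ball
  of radius \<open>r / 2\<close>. Thus all sufficiently small \<open>t > 0\<close> are admissible, because a bounded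
  sequence has one bound that works for all \<open>i\<close> at once; these \<open>t\<close> form an open interval.
\<close>

lemma meager_countable_UN:
  fixes S :: "nat \<Rightarrow> 'a::topological_space set"
  assumes "\<And>i. meager (S i)"
  shows "meager (\<Union>i. S i)"
proof -
  obtain N :: "nat \<Rightarrow> nat \<Rightarrow> 'a set"
    where nd: "\<And>i n. nowhere_dense (N i n)" and S: "\<And>i. S i = (\<Union>n. N i n)"
    using assms unfolding meager_def by metis
  define N' where "N' k = (case prod_decode k of (i, n) \<Rightarrow> N i n)" for k
  have "(\<Union>i. S i) = (\<Union>k. N' k)"
  proof
    show "(\<Union>i. S i) \<subseteq> (\<Union>k. N' k)"
    proof
      fix x assume "x \<in> (\<Union>i. S i)"
      then obtain i n where "x \<in> N i n" using S by auto
      then have "x \<in> N' (prod_encode (i, n))" by (simp add: N'_def)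
      then show "x \<in> (\<Union>k. N' k)" by blast
    qed
    show "(\<Union>k. N' k) \<subseteq> (\<Union>i. S i)"
      unfolding N'_def S by (auto split: prod.splits)
  qed
  moreover have "nowhere_dense (N' k)" for k
    using nd by (simp add: N'_def split: prod.split)
  ultimately show ?thesis unfolding meager_def by blast
qed

lemma nowhere_dense_translation:
  fixes S :: "'a::real_normed_vector set"
  assumes "nowhere_dense S"
  shows "nowhere_dense ((+) a ` S)"
  using assms by (simp add: nowhere_dense_def closure_translation interior_translation)

lemma meager_translation:
  fixes S :: "'a::real_normed_vector set"
  assumes "meager S"
  shows "meager ((+) a ` S)"
proof -
  obtain N :: "nat \<Rightarrow> 'a set" where "\<And>n. nowhere_dense (N n)" and "S = (\<Union>n. N n)"
    using assms unfolding meager_def by blast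
  then have "\<forall>n. nowhere_dense ((+) a ` N n)" and "(+) a ` S = (\<Union>n. (+) a ` N n)"
    by (auto intro: nowhere_dense_translation)
  then show ?thesis unfolding meager_def by (intro exI[of _ "\<lambda>n. (+) a ` N n"]) simp
qed

text \<open>This is the Baire category theorem: the complements of the closures of the nowhere dense pieces
  are open and dense, so their intersection is dense and meets every nonempty open set.\<close>

lemma open_diff_meager_nonempty:
  fixes U :: "'a::{real_normed_vector,heine_borel} set"
  assumes "open U" and "U \<noteq> {}" and "meager M"
  shows "U - M \<noteq> {}"
proof -
  obtain N :: "nat \<Rightarrow> 'a set" where nd: "\<And>n. nowhere_dense (N n)" and M: "M = (\<Union>n. N n)"
    using assms(3) unfolding meager_def by blast
  let ?G = "range (\<lambda>n. - closure (N n))"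
  have "UNIV \<subseteq> closure (\<Inter>?G)"
  proof (rule Baire)
    fix T assume "T \<in> ?G"
    then obtain n where T: "T = - closure (N n)" by auto
    have "closure T = UNIV"
      using nd[of n] by (simp add: T closure_complement nowhere_dense_def)
    then show "openin (top_of_set UNIV) T \<and> UNIV \<subseteq> closure T"
      by (simp add: T open_Compl)
  qed auto
  then have "U \<inter> (\<Inter>?G) \<noteq> {}"
    using open_Int_closure_eq_empty[OF assms(1), of "\<Inter>?G"] assms(2) by auto
  moreover have "\<Inter>?G \<subseteq> - M"
    unfolding M using closure_subset by blast
  ultimately show ?thesis by blast
qed

theorem theorem2p1:
  fixes A :: "(real ^ 'd) set" and v :: "nat \<Rightarrow> real ^ 'd"
  assumes "baire_set A" and "\<not> meager A" and "bounded (range v)"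
  shows "interior (pattern_scales v A) \<noteq> {}"
proof -
  obtain U M where U: "open U" and M: "meager M" and A: "A = sym_diff U M"
    using assms(1) unfolding baire_set_def by blast
  have "U \<noteq> {}" using A M assms(2) by auto
  then obtain c r where r: "r > 0" and ball: "ball c r \<subseteq> U"
    using U by (meson ex_in_conv openE)
  obtain B where B: "B > 0" and vB: "\<And>i. norm (v i) \<le> B"
    using assms(3) unfolding bounded_pos by auto
  define e where "e = r / (2 * B)"
  have e: "e > 0" using r B by (simp add: e_def)
  have "{0<..<e} \<subseteq> pattern_scales v A"
  proof
    fix t assume t: "t \<in> {0<..<e}"
    have small: "norm (t *\<^sub>R v i) < r / 2" for i
    proof -
      have "norm (t *\<^sub>R v i) \<le> t * B" using t vB[of i] by (simp add: mult_left_mono)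
      also have "\<dots> < e * B" using t B by simp
      also have "\<dots> = r / 2" using B by (simp add: e_def)
      finally show ?thesis .
    qed
    have "meager (\<Union>i. (+) (- (t *\<^sub>R v i)) ` M)"
      by (intro meager_countable_UN meager_translation M)
    then have "ball c (r / 2) - (\<Union>i. (+) (- (t *\<^sub>R v i)) ` M) \<noteq> {}"
      by (intro open_diff_meager_nonempty) (use r in simp_all)
    then obtain z where z: "z \<in> ball c (r / 2)"
      and avoid: "\<And>i. z \<notin> (+) (- (t *\<^sub>R v i)) ` M"
      by blast
    have "t *\<^sub>R v i + z \<in> A" for i
    proof -
      have "norm (c - z - t *\<^sub>R v i) < r"
        using z small[of i] norm_triangle_ineq4[of "c - z" "t *\<^sub>R v i"]
        by (simp add: dist_norm)
      then have "t *\<^sub>R v i + z \<in> ball c r"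
        by (simp add: dist_norm diff_diff_add add.commute)
      then have "t *\<^sub>R v i + z \<in> U"
        using ball by blast
      moreover have "t *\<^sub>R v i + z \<notin> M"
      proof
        assume "t *\<^sub>R v i + z \<in> M"
        then have "- (t *\<^sub>R v i) + (t *\<^sub>R v i + z) \<in> (+) (- (t *\<^sub>R v i)) ` M" by (rule imageI)
        then show False using avoid[of i] by simp
      qed
      ultimately show ?thesis using A by blast
    qed
    then show "t \<in> pattern_scales v A"
      using t unfolding pattern_scales_def by auto
  qed
  then have "{0<..<e} \<subseteq> interior (pattern_scales v A)"
    by (rule interior_maximal) simp
  moreover have "e / 2 \<in> {0<..<e}" using e by simp
  ultimately show ?thesis by blast
qed

end
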